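(* Let $P_q(t)=\sum_{n\geq1}\dfrac{[p_n]_q}{[n]_q}t^n\in\Lambda_K[[t]]$. Then \[ E(t)=\mathbf{e}_q\big[-P_q(-t)\big]_q . \]
   Context: Let $q$ be an indeterminate, $K$ a field containing $\mathbb{Q}(q)$, $\Lambda_K$ the algebra of symmetric functions in $x_1,x_2,\dots$ over $K$, $e_n$ the elementary symmetric functions ($e_0=1$), $E(t)=\sum_{n\ge0}e_nt^n$. $[n]_q=1+q+\cdots+q^{n-1}$ ($n\ge1$), $[0]_q=0$, $[n]_q!=[1]_q\cdots[n]_q$, $[0]_q!=1$. For a formal power series $F(t)$, $D_qF(t)=\dfrac{F(qt)-F(t)}{(q-1)t}$. The $q$-power sums $[p_n]_q\in\Lambda_K$ are defined by $\sum_{n\geq1}[p_n]_q(-t)^{n-1}=D_qE(t)/E(t)$. Gessel's $q$-composition: for $A$ a commutative algebra over a field containing $\mathbb{Q}(q)$ and $F\in A[[t]]$ with $F(0)=0$, set $F^{[0]}=1$ and, for $k\geq1$, let $F^{[k]}$ be the unique series with zero constant term such that $D_qF^{[k]}=[k]_qF^{[k-1]}D_qF$ (the coefficient of $t^n$ in $F^{[k]}$ vanishes for $n<k$). For $G(t)=\sum_{k\ge0}g_k t^k/[k]_q!\in A[[t]]$, define $G[F]_q=\sum_{k\geq0}g_k F^{[k]}/[k]_q!$. Finally $\mathbf{e}_q(t)=\sum_{n\geq0}t^n/[n]_q!$. *)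

theory Defs
  imports
    "HOL-Computational_Algebra.Computational_Algebra"
    "HOL-Library.Multiset"
begin

section \<open>Symmetric functions in infinitely many variables\<close>

lemma finite_mset_splits: "finite {(A, B). A + B = (M :: 'a multiset)}"
proof -
  have "finite {A. A \<subseteq># M}"
  proof (rule finite_subset)
    show "{A. A \<subseteq># M} \<subseteq> (\<Union>n\<in>{..size M}. multisets_of_size (set_mset M) n)"
      by (auto simp: multisets_of_size_def size_mset_mono dest: mset_subset_eqD)
  qed auto
  then have "finite ({A. A \<subseteq># M} \<times> {B. B \<subseteq># M})" by simp
  then show ?thesis
    by (rule finite_subset[rotated]) auto
qed

text \<open>
  The multiset \<open>M\<close> over \<open>nat\<close> stands for the monomial \<open>\<Prod>i. x\<^sub>i ^ count M i\<close> in the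
  variables \<open>x\<^sub>0, x\<^sub>1, \<dots>\<close> (so \<open>A + B\<close> is the product of monomials and \<open>size\<close> is the degree),
  and a function on multisets is the family of coefficients of a formal series.  A symmetric
  function is such a series of bounded degree, invariant under permutations of the variables.
\<close>

typedef (overloaded) ('k :: comm_ring_1) symfun =
  "{f :: nat multiset \<Rightarrow> 'k.
      (\<forall>\<pi> M. bij \<pi> \<longrightarrow> f (image_mset \<pi> M) = f M) \<and>
      (\<exists>d. \<forall>M. f M \<noteq> 0 \<longrightarrow> size M \<le> d)}"
  morphisms monom_coeff Abs_symfun
  by (rule exI[of _ "\<lambda>_. 0"]) auto

setup_lifting type_definition_symfun

lemma mset_splits_image:
  assumes "bij (\<pi> :: 'a \<Rightarrow> 'a)"
  shows "bij_betw (map_prod (image_mset \<pi>) (image_mset \<pi>))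
           {(A, B). A + B = M} {(A, B). A + B = image_mset \<pi> M}"
proof (rule bij_betwI[where g = "map_prod (image_mset (inv \<pi>)) (image_mset (inv \<pi>))"])
  have 1: "image_mset \<pi> (image_mset (inv \<pi>) A) = A" for A
    using assms by (simp add: multiset.map_comp bij_is_surj surj_iff[THEN iffD1])
  have 2: "image_mset (inv \<pi>) (image_mset \<pi> A) = A" for A
    using assms by (simp add: multiset.map_comp bij_is_inj inj_iff[THEN iffD1])
  show "map_prod (image_mset \<pi>) (image_mset \<pi>)
          \<in> {(A, B). A + B = M} \<rightarrow> {(A, B). A + B = image_mset \<pi> M}"
    by auto
  show "map_prod (image_mset (inv \<pi>)) (image_mset (inv \<pi>))
          \<in> {(A, B). A + B = image_mset \<pi> M} \<rightarrow> {(A, B). A + B = M}"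
    using 2 by (auto simp flip: image_mset_union)
  show "map_prod (image_mset (inv \<pi>)) (image_mset (inv \<pi>))
          (map_prod (image_mset \<pi>) (image_mset \<pi>) x) = x" for x
    using 2 by (cases x) (simp)
  show "map_prod (image_mset \<pi>) (image_mset \<pi>)
          (map_prod (image_mset (inv \<pi>)) (image_mset (inv \<pi>)) x) = x" for x
    using 1 by (cases x) (simp)
qed

instantiation symfun :: (comm_ring_1) comm_ring_1
begin

lift_definition zero_symfun :: "'a symfun" is "\<lambda>_. 0" by auto

lift_definition one_symfun :: "'a symfun" is "\<lambda>M. if M = {#} then 1 else 0" by auto

lift_definition plus_symfun :: "'a symfun \<Rightarrow> 'a symfun \<Rightarrow> 'a symfun"
  is "\<lambda>f g M. f M + g M"
proof safe
  fix f g :: "nat multiset \<Rightarrow> 'a" and d e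
  assume "\<forall>M. f M \<noteq> 0 \<longrightarrow> size M \<le> d" "\<forall>M. g M \<noteq> 0 \<longrightarrow> size M \<le> e"
  then show "\<exists>d. \<forall>M. f M + g M \<noteq> 0 \<longrightarrow> size M \<le> d"
    by (intro exI[of _ "max d e"]) (metis add_0 le_max_iff_disj)
qed auto

lift_definition uminus_symfun :: "'a symfun \<Rightarrow> 'a symfun" is "\<lambda>f M. - f M" by auto

lift_definition minus_symfun :: "'a symfun \<Rightarrow> 'a symfun \<Rightarrow> 'a symfun"
  is "\<lambda>f g M. f M - g M"
proof safe
  fix f g :: "nat multiset \<Rightarrow> 'a" and d e
  assume "\<forall>M. f M \<noteq> 0 \<longrightarrow> size M \<le> d" "\<forall>M. g M \<noteq> 0 \<longrightarrow> size M \<le> e"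
  then show "\<exists>d. \<forall>M. f M - g M \<noteq> 0 \<longrightarrow> size M \<le> d"
    by (intro exI[of _ "max d e"]) (metis diff_0_right le_max_iff_disj)
qed auto

lift_definition times_symfun :: "'a symfun \<Rightarrow> 'a symfun \<Rightarrow> 'a symfun"
  is "\<lambda>f g M. \<Sum>(A, B) \<in> {(A, B). A + B = M}. f A * g B"
proof safe
  fix f g :: "nat multiset \<Rightarrow> 'a" and \<pi> :: "nat \<Rightarrow> nat" and M
  assume f: "\<forall>\<pi> M. bij \<pi> \<longrightarrow> f (image_mset \<pi> M) = f M"
    and g: "\<forall>\<pi> M. bij \<pi> \<longrightarrow> g (image_mset \<pi> M) = g M" and "bij \<pi>"
  show "(\<Sum>(A, B) \<in> {(A, B). A + B = image_mset \<pi> M}. f A * g B)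
      = (\<Sum>(A, B) \<in> {(A, B). A + B = M}. f A * g B)"
    by (subst sum.reindex_bij_betw[OF mset_splits_image[OF \<open>bij \<pi>\<close>], symmetric])
       (use f g \<open>bij \<pi>\<close> in \<open>auto intro!: sum.cong\<close>)
next
  fix f g :: "nat multiset \<Rightarrow> 'a" and d e
  assume f: "\<forall>M. f M \<noteq> 0 \<longrightarrow> size M \<le> d" and g: "\<forall>M. g M \<noteq> 0 \<longrightarrow> size M \<le> e"
  show "\<exists>d. \<forall>M. (\<Sum>(A, B) \<in> {(A, B). A + B = M}. f A * g B) \<noteq> 0 \<longrightarrow> size M \<le> d"
  proof (intro exI[of _ "d + e"] allI impI)
    fix M assume "(\<Sum>(A, B) \<in> {(A, B). A + B = M}. f A * g B) \<noteq> 0"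
    then obtain A B where "A + B = M" "f A * g B \<noteq> 0"
      by (auto elim!: sum.not_neutral_contains_not_neutral)
    then have "f A \<noteq> 0" "g B \<noteq> 0" by auto
    then have "size A \<le> d" "size B \<le> e" using f g by blast+
    with \<open>A + B = M\<close> show "size M \<le> d + e" by auto
  qed
qed

instance
proof
  fix a b c :: "'a symfun"
  show "a * b * c = a * (b * c)"
  proof (transfer, rule ext)
    fix f g h :: "nat multiset \<Rightarrow> 'a" and M
    have "(\<Sum>(D, C) \<in> {(D, C). D + C = M}. (\<Sum>(A, B) \<in> {(A, B). A + B = D}. f A * g B) * h C)
        = (\<Sum>((D, C), (A, B)) \<in> (SIGMA p:{(D, C). D + C = M}. {(A, B). A + B = fst p}).
             f A * g B * h C)"
      by (subst sum.Sigma[symmetric])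
         (auto simp: finite_mset_splits finite_mset_splits[unfolded case_prod_unfold]
               sum_distrib_right case_prod_unfold intro!: sum.cong)
    also have "\<dots> = (\<Sum>((A, D), (B, C)) \<in> (SIGMA p:{(A, D). A + D = M}. {(B, C). B + C = snd p}).
             f A * g B * h C)"
      by (rule sum.reindex_bij_witness[where
            i = "\<lambda>((A, D), (B, C)). ((A + B, C), (A, B))" and
            j = "\<lambda>((D, C), (A, B)). ((A, B + C), (B, C))"])
         (auto simp: add.assoc)
    also have "\<dots> = (\<Sum>(A, D) \<in> {(A, D). A + D = M}.
                      f A * (\<Sum>(B, C) \<in> {(B, C). B + C = D}. g B * h C))"
      by (subst sum.Sigma[symmetric])
         (auto simp: finite_mset_splits finite_mset_splits[unfolded case_prod_unfold]
               sum_distrib_left case_prod_unfold mult.assoc intro!: sum.cong)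
    finally show "(\<Sum>(D, C) \<in> {(D, C). D + C = M}.
                     (\<Sum>(A, B) \<in> {(A, B). A + B = D}. f A * g B) * h C)
        = (\<Sum>(A, D) \<in> {(A, D). A + D = M}.
             f A * (\<Sum>(B, C) \<in> {(B, C). B + C = D}. g B * h C))" .
  qed
  show "a * b = b * a"
    by (transfer, rule ext, rule sum.reindex_bij_witness[where i = prod.swap and j = prod.swap])
       (auto simp: add.commute mult.commute)
  show "1 * a = a"
  proof (transfer, rule ext)
    fix f :: "nat multiset \<Rightarrow> 'a" and M
    have "(\<Sum>(A, B) \<in> {(A, B). A + B = M}. (if A = {#} then 1 else 0) * f B)
        = (\<Sum>(A, B) \<in> {({#} :: nat multiset, M)}. (if A = {#} then 1 else 0) * f B)"
      by (rule sum.mono_neutral_right) (auto simp: finite_mset_splits split: if_splits)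
    then show "(\<Sum>(A, B) \<in> {(A, B). A + B = M}. (if A = {#} then 1 else 0) * f B) = f M"
      by simp
  qed
  show "(a + b) * c = a * c + b * c"
    by (transfer, rule ext)
       (simp add: case_prod_unfold distrib_right sum.distrib)
  show "a + b + c = a + (b + c)" by transfer (simp add: add.assoc)
  show "a + b = b + a" by transfer (simp add: add.commute)
  show "0 + a = a" by transfer simp
  show "- a + a = 0" by transfer simp
  show "a - b = a + - b" by transfer simp
  show "(0 :: 'a symfun) \<noteq> 1" by transfer (auto dest: fun_cong[of _ _ "{#}"])
qed

end

definition unital_ring_hom :: "('a :: comm_ring_1 \<Rightarrow> 'b :: comm_ring_1) \<Rightarrow> bool" where
  "unital_ring_hom f \<longleftrightarrow>
     f 1 = 1 \<and> (\<forall>x y. f (x + y) = f x + f y) \<and> (\<forall>x y. f (x * y) = f x * f y)"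

lift_definition symfun_const :: "'k :: comm_ring_1 \<Rightarrow> 'k symfun"
  is "\<lambda>c M. if M = {#} then c else 0" by auto

lemma unital_ring_hom_symfun_const: "unital_ring_hom symfun_const"
  unfolding unital_ring_hom_def
proof (intro conjI allI)
  fix x y :: 'a
  show "symfun_const (x * y) = symfun_const x * symfun_const y"
  proof (transfer, rule ext)
    fix x y :: 'a and M :: "nat multiset"
    have "(\<Sum>(A, B) \<in> {(A, B). A + B = M}. (if A = {#} then x else 0) * (if B = {#} then y else 0))
        = (\<Sum>(A, B) \<in> {({#} :: nat multiset, M)}. (if A = {#} then x else 0) * (if B = {#} then y else 0))"
      by (rule sum.mono_neutral_right) (auto simp: finite_mset_splits split: if_splits)
    then show "(if M = {#} then x * y else 0) = (\<Sum>(A, B) \<in> {(A, B). A + B = M}.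
        (if A = {#} then x else 0) * (if B = {#} then y else 0))"
      by simp
  qed
qed (transfer, auto)+

text \<open>\<open>e\<^sub>n = \<Sum>S. \<Prod>i\<in>S. x\<^sub>i\<close>, where \<open>S\<close> runs over the \<open>n\<close>-element sets of indices.\<close>

lift_definition elem_symfun :: "nat \<Rightarrow> ('k :: comm_ring_1) symfun"
  is "\<lambda>n M. if \<exists>S. finite S \<and> card S = n \<and> M = mset_set S then 1 else 0"
proof safe
  fix n :: nat and \<pi> :: "nat \<Rightarrow> nat" and M :: "nat multiset"
  assume \<pi>: "bij \<pi>"
  have *: "\<exists>T. finite T \<and> card T = n \<and> image_mset \<sigma> N = mset_set T"
    if "bij \<sigma>" "finite S" "card S = n" "N = mset_set S"
    for \<sigma> :: "nat \<Rightarrow> nat" and N S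
  proof -
    have "inj_on \<sigma> S" using that(1) by (meson bij_is_inj inj_on_subset subset_UNIV)
    then show ?thesis using that
      by (intro exI[of _ "\<sigma> ` S"]) (simp add: card_image image_mset_mset_set)
  qed
  have "image_mset (inv \<pi>) (image_mset \<pi> M) = M"
    using \<pi> by (simp add: multiset.map_comp bij_is_inj inj_iff[THEN iffD1])
  then have "(\<exists>S. finite S \<and> card S = n \<and> image_mset \<pi> M = mset_set S)
      \<longleftrightarrow> (\<exists>S. finite S \<and> card S = n \<and> M = mset_set S)"
    using *[OF \<pi>, of _ M] *[OF bij_imp_bij_inv[OF \<pi>], of _ "image_mset \<pi> M"] by metis
  then show "(if \<exists>S. finite S \<and> card S = n \<and> image_mset \<pi> M = mset_set S then 1 else 0 :: 'k)
      = (if \<exists>S. finite S \<and> card S = n \<and> M = mset_set S then 1 else 0)"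
    by simp
next
  fix n :: nat
  show "\<exists>d. \<forall>M. (if \<exists>S. finite S \<and> card S = n \<and> M = mset_set S then 1 else 0 :: 'k) \<noteq> 0
      \<longrightarrow> size M \<le> d"
    by (rule exI[of _ n]) auto
qed

lemma elem_symfun_0 [simp]: "elem_symfun 0 = 1"
proof -
  have "(\<exists>S. finite S \<and> card S = 0 \<and> M = mset_set S) \<longleftrightarrow> M = {#}" for M :: "nat multiset"
    by (metis card_0_eq finite.emptyI mset_set.empty)
  then show ?thesis
    by (simp add: elem_symfun.rep_eq one_symfun.rep_eq fun_eq_iff flip: monom_coeff_inject)
qed

definition elem_gf :: "('k :: comm_ring_1) symfun fps" where
  "elem_gf = Abs_fps elem_symfun"


section \<open>\<open>q\<close>-calculus of formal power series\<close>

definition q_int :: "'k :: field \<Rightarrow> nat \<Rightarrow> 'k" where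
  "q_int q n = (\<Sum>i<n. q ^ i)"

definition q_fact :: "'k :: field \<Rightarrow> nat \<Rightarrow> 'k" where
  "q_fact q n = (\<Prod>i = 1..n. q_int q i)"

text \<open>
  Below, \<open>\<iota> :: 'k \<Rightarrow> 'a\<close> is the structure map (a unital ring homomorphism) that makes \<open>'a\<close> an
  algebra over the field \<open>'k\<close>.  The numerator in the \<open>q\<close>-derivative has no constant term, so that
  \<open>fps_shift 1\<close> is the division by \<open>t\<close>.
\<close>

definition q_deriv :: "('k :: field \<Rightarrow> 'a :: comm_ring_1) \<Rightarrow> 'k \<Rightarrow> 'a fps \<Rightarrow> 'a fps" where
  "q_deriv \<iota> q F =
     fps_const (\<iota> (inverse (q - 1))) * fps_shift 1 ((F oo (fps_const (\<iota> q) * fps_X)) - F)"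

primrec q_power :: "('k :: field \<Rightarrow> 'a :: comm_ring_1) \<Rightarrow> 'k \<Rightarrow> 'a fps \<Rightarrow> nat \<Rightarrow> 'a fps" where
  "q_power \<iota> q F 0 = 1"
| "q_power \<iota> q F (Suc k) =
     (THE H. fps_nth H 0 = 0 \<and>
        q_deriv \<iota> q H = fps_const (\<iota> (q_int q (Suc k))) * q_power \<iota> q F k * q_deriv \<iota> q F)"

text \<open>
  If \<open>G = \<Sum>k. g\<^sub>k t\<^sup>k / [k]!\<close>, then \<open>g\<^sub>k\<close> is \<open>[k]!\<close> times the coefficient of \<open>t\<^sup>k\<close> in \<open>G\<close>.
  The infinite sum is taken in the \<open>t\<close>-adic topology.
\<close>

definition q_compose ::
    "('k :: field \<Rightarrow> 'a :: comm_ring_1) \<Rightarrow> 'k \<Rightarrow> 'a fps \<Rightarrow> 'a fps \<Rightarrow> 'a fps" where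
  "q_compose \<iota> q G F =
     (let g = (\<lambda>k. \<iota> (q_fact q k) * fps_nth G k)
      in \<Sum>k. fps_const (g k * \<iota> (inverse (q_fact q k))) * q_power \<iota> q F k)"

definition q_exp :: "('k :: field \<Rightarrow> 'a :: comm_ring_1) \<Rightarrow> 'k \<Rightarrow> 'a fps" where
  "q_exp \<iota> q = Abs_fps (\<lambda>n. \<iota> (inverse (q_fact q n)))"

lemma unital_ring_hom_simps:
  assumes "unital_ring_hom f"
  shows "f 1 = 1" "f (x + y) = f x + f y" "f (x * y) = f x * f y" "f 0 = 0"
    "f (x - y) = f x - f y" "f (x ^ n) = f x ^ n"
proof -
  show *: "f 1 = 1" "f (x + y) = f x + f y" "f (x * y) = f x * f y" for x y
    using assms by (auto simp: unital_ring_hom_def)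
  show "f 0 = 0" using *(2)[of 0 0] by simp
  show "f (x - y) = f x - f y" using *(2)[of "x - y" y] by simp
  show "f (x ^ n) = f x ^ n" by (induction n) (simp_all add: *)
qed

lemma q_deriv_nth:
  assumes \<iota>: "unital_ring_hom \<iota>" and "q \<noteq> 1"
  shows "fps_nth (q_deriv \<iota> q F) n = \<iota> (q_int q (Suc n)) * fps_nth F (Suc n)"
proof -
  have "(q - 1) * q_int q (Suc n) = q ^ Suc n - 1"
    unfolding q_int_def by (rule power_diff_1_eq[symmetric])
  then have "q_int q (Suc n) = inverse (q - 1) * (q ^ Suc n - 1)"
    using \<open>q \<noteq> 1\<close> by (simp add: field_simps)
  then have "\<iota> (q_int q (Suc n)) = \<iota> (inverse (q - 1)) * (\<iota> q ^ Suc n - 1)"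
    by (simp add: unital_ring_hom_simps[OF \<iota>] del: power_Suc)
  then show ?thesis
    by (simp add: q_deriv_def fps_compose_linear left_diff_distrib mult.assoc del: power_Suc)
qed

text \<open>
  The recursive description of \<^const>\<open>q_power\<close> determines a unique series.
\<close>

lemma q_power_ex1:
  assumes \<iota>: "unital_ring_hom \<iota>" and "q \<noteq> 1" and q: "\<And>n. n > 0 \<Longrightarrow> q_int q n \<noteq> 0"
  shows "\<exists>!H. fps_nth H 0 = 0 \<and> q_deriv \<iota> q H = R"
proof -
  have inv: "\<iota> (q_int q (Suc n)) * \<iota> (inverse (q_int q (Suc n))) = 1" for n
    using q[of "Suc n"] by (simp flip: unital_ring_hom_simps(3)[OF \<iota>]
                              add: unital_ring_hom_simps(1)[OF \<iota>])
  define H where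
    "H = Abs_fps (\<lambda>n. if n = 0 then 0 else \<iota> (inverse (q_int q n)) * fps_nth R (n - 1))"
  show ?thesis
  proof (rule ex1I[of _ H])
    show "fps_nth H 0 = 0 \<and> q_deriv \<iota> q H = R"
      using inv by (auto simp: H_def fps_eq_iff q_deriv_nth[OF \<iota> \<open>q \<noteq> 1\<close>] simp flip: mult.assoc)
  next
    fix H' assume H': "fps_nth H' 0 = 0 \<and> q_deriv \<iota> q H' = R"
    show "H' = H"
    proof (rule fps_ext)
      fix n
      show "fps_nth H' n = fps_nth H n"
      proof (cases n)
        case 0
        then show ?thesis using H' by (simp add: H_def)
      next
        case (Suc m)
        have "fps_nth R m = \<iota> (q_int q (Suc m)) * fps_nth H' (Suc m)"
          using H' q_deriv_nth[OF \<iota> \<open>q \<noteq> 1\<close>, of H' m] by simp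
        then have "fps_nth H (Suc m)
            = (\<iota> (q_int q (Suc m)) * \<iota> (inverse (q_int q (Suc m)))) * fps_nth H' (Suc m)"
          by (simp add: H_def mult_ac)
        then show ?thesis using inv Suc by simp
      qed
    qed
  qed
qed


section \<open>\<open>q\<close>-power sums\<close>

text \<open>
  \<open>E\<close> has constant term \<open>1\<close>, so that \<open>fps_right_inverse E 1\<close> is its multiplicative inverse; the
  coefficient of \<open>t\<^sup>n\<^sup>-\<^sup>1\<close> in the defining identity \<open>\<Sum>n\<ge>1. [p\<^sub>n] (-t)\<^sup>n\<^sup>-\<^sup>1 = D\<^sub>q E / E\<close> is
  \<open>(-1)\<^sup>n\<^sup>-\<^sup>1 [p\<^sub>n]\<close>.  Only the values at \<open>n \<ge> 1\<close> are meaningful.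
\<close>

definition q_power_sum :: "'k :: field \<Rightarrow> nat \<Rightarrow> 'k symfun" where
  "q_power_sum q n =
     (-1) ^ (n - 1) * fps_nth (q_deriv symfun_const q elem_gf * fps_right_inverse elem_gf 1) (n - 1)"

lemma q_power_sum_identity:
  "Abs_fps (\<lambda>n. q_power_sum q (Suc n)) oo (- fps_X)
     = q_deriv symfun_const q elem_gf * fps_right_inverse elem_gf 1"
  "elem_gf * fps_right_inverse elem_gf 1 = (1 :: ('k :: field) symfun fps)"
proof -
  show "Abs_fps (\<lambda>n. q_power_sum q (Suc n)) oo (- fps_X)
     = q_deriv symfun_const q elem_gf * fps_right_inverse elem_gf 1"
    by (rule fps_ext) (simp add: fps_compose_uminus' q_power_sum_def)
  show "elem_gf * fps_right_inverse elem_gf 1 = (1 :: 'k symfun fps)"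
    by (rule fps_right_inverse) (simp add: elem_gf_def)
qed

definition q_power_sum_gf :: "'k :: field \<Rightarrow> 'k symfun fps" where
  "q_power_sum_gf q =
     Abs_fps (\<lambda>n. if n = 0 then 0 else symfun_const (inverse (q_int q n)) * q_power_sum q n)"

end

theory Submission
  imports Defs
begin

text \<open>
  Both sides solve the linear \<open>q\<close>-differential equation \<open>D\<^sub>q S = S \<cdot> D\<^sub>q F\<close> with \<open>S(0) = 1\<close>, where
  \<open>F(t) = - P\<^sub>q(-t)\<close>: for \<open>E\<close> this is the definition of the \<open>q\<close>-power sums, and for \<open>e\<^sub>q[F]\<close> it is
  obtained by differentiating termwise.  Comparing coefficients, the solution is unique as long as no
  \<open>[n]\<^sub>q\<close> with \<open>n \<ge> 1\<close> vanishes.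
\<close>

lemma q_fact_Suc: "q_fact q (Suc n) = q_fact q n * q_int q (Suc n)"
  by (simp add: q_fact_def)

lemma q_fact_0 [simp]: "q_fact q 0 = 1"
  by (simp add: q_fact_def)

lemma q_fact_nonzero:
  assumes "\<And>n. n > 0 \<Longrightarrow> q_int q n \<noteq> 0"
  shows "q_fact q n \<noteq> 0"
  using assms by (simp add: q_fact_def)

lemma unital_ring_hom_inverse:
  assumes "unital_ring_hom (\<iota> :: 'k :: field \<Rightarrow> 'a :: comm_ring_1)" and "x \<noteq> 0"
  shows "\<iota> x * \<iota> (inverse x) = 1"
  using assms(2)
  by (simp add: unital_ring_hom_simps(1)[OF assms(1)] flip: unital_ring_hom_simps(3)[OF assms(1)])

lemma unital_ring_hom_nonzero:
  assumes "unital_ring_hom (\<phi> :: 'k :: field \<Rightarrow> 'a :: comm_ring_1)" and "x \<noteq> 0"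
  shows "\<phi> x \<noteq> 0"
  using unital_ring_hom_inverse[OF assms] by auto

text \<open>Coefficient \<open>n\<close> of the partial sums no longer changes once
  \<open>m > n\<close>, which is convergence in the \<open>t\<close>-adic topology. This evaluates
  the infinite sum in \<open>q_compose\<close>.\<close>

lemma fps_sums_if_nth_eventually_zero:
  fixes f :: "nat \<Rightarrow> 'a :: comm_ring_1 fps"
  assumes "\<And>k n. n < k \<Longrightarrow> fps_nth (f k) n = 0"
  shows "f sums Abs_fps (\<lambda>n. \<Sum>k\<le>n. fps_nth (f k) n)"
  unfolding sums_def
proof (rule tendsto_fpsI)
  fix n
  have "fps_nth (\<Sum>k<m. f k) n = (\<Sum>k\<le>n. fps_nth (f k) n)" if "m > n" for m
    unfolding fps_sum_nth using assms that
    by (intro sum.mono_neutral_right) auto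
  then show "\<forall>\<^sub>F m in sequentially.
      fps_nth (\<Sum>k<m. f k) n = fps_nth (Abs_fps (\<lambda>n. \<Sum>k\<le>n. fps_nth (f k) n)) n"
    by (auto intro: eventually_sequentiallyI[of "Suc n"])
qed

context
  fixes \<iota> :: "'k :: field \<Rightarrow> 'a :: comm_ring_1" and q :: 'k
  assumes hom: "unital_ring_hom \<iota>" and q_neq_1: "q \<noteq> 1"
    and q_int_nonzero: "\<And>n. n > 0 \<Longrightarrow> q_int q n \<noteq> 0"
begin

text \<open>Unique existence turns the \<open>THE\<close> of the recursion into usable equations;
  later proofs rewrite with these and keep \<open>q_power.simps\<close> out of the
  simplifier.\<close>

lemma q_power_Suc_props:
  shows q_power_Suc_nth_0: "fps_nth (q_power \<iota> q F (Suc k)) 0 = 0"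
    and q_deriv_q_power_Suc: "q_deriv \<iota> q (q_power \<iota> q F (Suc k))
      = fps_const (\<iota> (q_int q (Suc k))) * q_power \<iota> q F k * q_deriv \<iota> q F"
  using theI'[OF q_power_ex1[OF hom q_neq_1 q_int_nonzero,
      of "fps_const (\<iota> (q_int q (Suc k))) * q_power \<iota> q F k * q_deriv \<iota> q F"]]
  by simp_all

text \<open>The algebra \<open>'a\<close> may have zero divisors, so one multiplies by the image of
  the inverse taken in the field \<open>'k\<close>.\<close>

lemma q_int_cancel:
  assumes "\<iota> (q_int q (Suc n)) * a = \<iota> (q_int q (Suc n)) * b"
  shows "a = b"
proof -
  have "\<iota> (inverse (q_int q (Suc n))) * (\<iota> (q_int q (Suc n)) * c) = c" for c
    using unital_ring_hom_inverse[OF hom q_int_nonzero, of "Suc n"]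
    by (metis mult.assoc mult.commute mult_1_left zero_less_Suc)
  then show ?thesis using assms by metis
qed

text \<open>Up to the unit [m+1], coefficient m+1 of the power k+1 is coefficient m of the power k
  times \<open>q_deriv\<close> of F, which involves only coefficients of the power k of index at
  most m < k.\<close>

lemma q_power_nth_eq_0:
  "n < k \<Longrightarrow> fps_nth (q_power \<iota> q F k) n = 0"
proof (induction k arbitrary: n)
  case (Suc k)
  show ?case
  proof (cases n)
    case 0
    then show ?thesis by (simp only: q_power_Suc_nth_0)
  next
    case (Suc m)
    have "fps_nth (q_power \<iota> q F k * q_deriv \<iota> q F) m = 0"
      unfolding fps_mult_nth using Suc Suc.IH Suc.prems by (intro sum.neutral) auto
    then have "\<iota> (q_int q (Suc m)) * fps_nth (q_power \<iota> q F (Suc k)) (Suc m) = 0"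
      by (simp add: mult.assoc q_deriv_q_power_Suc
            del: q_power.simps flip: q_deriv_nth[OF hom q_neq_1])
    then show ?thesis
      using q_int_cancel[of m _ 0] Suc by simp
  qed
qed simp

text \<open>Coefficient m of S * G uses only the coefficients of S up to m, so the equation is a
  recursion for coefficient m+1.\<close>

lemma q_deriv_linear_unique:
  assumes "q_deriv \<iota> q S = S * G" and "q_deriv \<iota> q T = T * G"
    and "fps_nth S 0 = fps_nth T 0"
  shows "S = T"
proof (rule fps_ext)
  show "fps_nth S n = fps_nth T n" for n
  proof (induction n rule: less_induct)
    case (less n)
    show ?case
    proof (cases n)
      case (Suc m)
      have "fps_nth (S * G) m = fps_nth (T * G) m"
        unfolding fps_mult_nth using less Suc by (intro sum.cong) auto
      then have "\<iota> (q_int q (Suc m)) * fps_nth S (Suc m) = \<iota> (q_int q (Suc m)) * fps_nth T (Suc m)"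
        using assms by (simp flip: q_deriv_nth[OF hom q_neq_1])
      then show ?thesis
        using q_int_cancel Suc by blast
    qed (use assms in simp)
  qed
qed

text \<open>Every g_k of the q-exponential is 1, and terms with k > n do not reach coefficient
  n.\<close>

lemma q_compose_q_exp:
  "q_compose \<iota> q (q_exp \<iota> q) F
    = Abs_fps (\<lambda>n. \<Sum>k\<le>n. \<iota> (inverse (q_fact q k)) * fps_nth (q_power \<iota> q F k) n)"
proof -
  have "\<iota> (q_fact q k) * \<iota> (inverse (q_fact q k)) = 1" for k
    using unital_ring_hom_inverse[OF hom q_fact_nonzero[OF q_int_nonzero]] .
  then have "q_compose \<iota> q (q_exp \<iota> q) F
      = (\<Sum>k. fps_const (\<iota> (inverse (q_fact q k))) * q_power \<iota> q F k)"
    by (simp add: q_compose_def q_exp_def)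
  also have "\<dots> = Abs_fps (\<lambda>n. \<Sum>k\<le>n. \<iota> (inverse (q_fact q k)) * fps_nth (q_power \<iota> q F k) n)"
    using fps_sums_if_nth_eventually_zero[of "\<lambda>k. fps_const (\<iota> (inverse (q_fact q k))) * q_power \<iota> q F k"]
    by (simp add: q_power_nth_eq_0 sums_iff)
  finally show ?thesis .
qed

lemma q_deriv_q_compose_q_exp:
  "q_deriv \<iota> q (q_compose \<iota> q (q_exp \<iota> q) F)
    = q_compose \<iota> q (q_exp \<iota> q) F * q_deriv \<iota> q F"
proof (rule fps_ext)
  fix n
  let ?c = "\<lambda>k. \<iota> (inverse (q_fact q k))" and ?P = "q_power \<iota> q F" and ?D = "q_deriv \<iota> q"
  \<comment> \<open>This makes the derivative of term k+1 equal to term k times \<open>?D F\<close>,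
    as for the ordinary exponential.\<close>
  have c_Suc: "?c (Suc k) * \<iota> (q_int q (Suc k)) = ?c k" for k
    using q_int_nonzero[of "Suc k"]
    by (simp add: q_fact_Suc field_simps flip: unital_ring_hom_simps(3)[OF hom])
  have "fps_nth (?D (q_compose \<iota> q (q_exp \<iota> q) F)) n
      = (\<Sum>k\<le>Suc n. ?c k * fps_nth (?D (?P k)) n)"
    by (simp add: q_deriv_nth[OF hom q_neq_1] q_compose_q_exp sum_distrib_left mult.left_commute
          distrib_left del: q_power.simps)
  \<comment> \<open>The term k = 0 drops out because \<open>?P 0\<close> is the constant 1.\<close>
  also have "\<dots> = (\<Sum>k\<le>n. ?c (Suc k) * fps_nth (?D (?P (Suc k))) n)"
    by (subst sum.atMost_Suc_shift) (simp add: q_deriv_nth[OF hom q_neq_1] del: q_power.simps(2))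
  also have "\<dots> = (\<Sum>k\<le>n. ?c k * fps_nth (?P k * ?D F) n)"
    by (simp only: q_deriv_q_power_Suc mult.assoc fps_mult_left_const_nth)
       (simp add: c_Suc flip: mult.assoc)
  also have "\<dots> = (\<Sum>i=0..n. \<Sum>k\<le>n. ?c k * fps_nth (?P k) i * fps_nth (?D F) (n - i))"
    by (simp add: fps_mult_nth sum_distrib_left mult.assoc) (rule sum.swap)
  \<comment> \<open>Coefficient i of \<open>?P k\<close> vanishes for k > i; the inner sum becomes
    coefficient i of the composition.\<close>
  also have "\<dots> = (\<Sum>i=0..n. \<Sum>k\<le>i. ?c k * fps_nth (?P k) i * fps_nth (?D F) (n - i))"
    by (intro sum.cong[OF refl] sum.mono_neutral_right) (auto simp: q_power_nth_eq_0)
  also have "\<dots> = fps_nth (q_compose \<iota> q (q_exp \<iota> q) F * ?D F) n"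
    by (simp add: fps_mult_nth q_compose_q_exp sum_distrib_right)
  finally show "fps_nth (?D (q_compose \<iota> q (q_exp \<iota> q) F)) n
      = fps_nth (q_compose \<iota> q (q_exp \<iota> q) F * ?D F) n" .
qed

end

text \<open>The factor [n+1] from \<open>q_deriv\<close> cancels the denominator, and the outer
  minus sign turns (-1)^(n+1) into (-1)^n, leaving the series that defines the q-power sums.\<close>

lemma q_deriv_q_power_sum_gf:
  fixes q :: "'k :: field"
  assumes "q \<noteq> 1" and "\<And>n. n > 0 \<Longrightarrow> q_int q n \<noteq> 0"
  shows "q_deriv symfun_const q (- (q_power_sum_gf q oo (- fps_X)))
    = q_deriv symfun_const q elem_gf * fps_right_inverse elem_gf 1"
proof -
  have "symfun_const (q_int q (Suc n)) * (symfun_const (inverse (q_int q (Suc n))) * a) = a" for n a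
    using unital_ring_hom_inverse[OF unital_ring_hom_symfun_const assms(2), of "Suc n"]
    by (simp flip: mult.assoc)
  then show ?thesis
    by (intro fps_ext)
       (simp add: q_deriv_nth[OF unital_ring_hom_symfun_const assms(1)] fps_compose_uminus'
          q_power_sum_gf_def mult.left_commute[of "symfun_const _" "(-1) ^ _"]
          flip: q_power_sum_identity(1))
qed

text \<open>As a polynomial in the indeterminate, [n] takes the value n at 1, so it is nonzero over
  the rationals; a unital homomorphism from a field sends no nonzero element to 0.\<close>

lemma q_int_image_indeterminate_nonzero:
  fixes \<phi> :: "rat poly fract \<Rightarrow> 'k :: field"
  assumes \<phi>: "unital_ring_hom \<phi>" and "n > 0"
  shows "q_int (\<phi> (Fract [:0, 1:] 1)) n \<noteq> 0"
proof -
  have \<phi>_sum: "\<phi> (\<Sum>i<m. f i) = (\<Sum>i<m. \<phi> (f i))" for f and m :: nat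
    by (induction m) (simp_all add: unital_ring_hom_simps[OF \<phi>])
  have to_fract_pow: "to_fract (p ^ i) = to_fract p ^ i" for p :: "rat poly" and i
    by (induction i) simp_all
  have "poly (\<Sum>i<n. [:0, 1:] ^ i) (1 :: rat) = of_nat n"
    by (simp add: poly_sum)
  with \<open>n > 0\<close> have "(\<Sum>i<n. [:0, 1:] ^ i) \<noteq> (0 :: rat poly)"
    by auto
  then have "\<phi> (to_fract (\<Sum>i<n. [:0, 1:] ^ i)) \<noteq> 0"
    by (intro unital_ring_hom_nonzero[OF \<phi>]) (simp del: to_fract_sum)
  then show ?thesis
    by (simp add: q_int_def to_fract_pow \<phi>_sum unital_ring_hom_simps[OF \<phi>])
       (simp add: to_fract_def)
qed

lemma image_indeterminate_neq_1:
  fixes \<phi> :: "rat poly fract \<Rightarrow> 'k :: field"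
  assumes \<phi>: "unital_ring_hom \<phi>"
  shows "\<phi> (Fract [:0, 1:] 1) \<noteq> 1"
proof -
  have "to_fract [:0, 1:] - 1 \<noteq> (0 :: rat poly fract)"
    by (metis diff_add_cancel add_0 to_fract_1 to_fract_eq_iff one_pCons pCons_eq_iff zero_neq_one)
  then have "\<phi> (to_fract [:0, 1:] - 1) \<noteq> 0"
    by (rule unital_ring_hom_nonzero[OF \<phi>])
  then show ?thesis
    by (simp add: unital_ring_hom_simps[OF \<phi>] to_fract_def)
qed

theorem theorem5p5:
  fixes \<phi> :: "rat poly fract \<Rightarrow> 'k :: field" and q :: 'k
  assumes "unital_ring_hom \<phi>"
    and "q = \<phi> (Fract [:0, 1:] 1)"
  shows "elem_gf = q_compose symfun_const q (q_exp symfun_const q) (- (q_power_sum_gf q oo (- fps_X)))"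
proof -
  have q: "q \<noteq> 1" "\<And>n. n > 0 \<Longrightarrow> q_int q n \<noteq> 0"
    using image_indeterminate_neq_1 q_int_image_indeterminate_nonzero assms by auto
  note facts = unital_ring_hom_symfun_const q
  let ?F = "- (q_power_sum_gf q oo (- fps_X))"
  show ?thesis
  proof (rule q_deriv_linear_unique[OF facts])
    show "q_deriv symfun_const q elem_gf = elem_gf * q_deriv symfun_const q ?F"
      \<comment> \<open>Since \<open>q_deriv\<close> of \<open>?F\<close> is that of
        \<open>elem_gf\<close> divided by \<open>elem_gf\<close>, the factor \<open>elem_gf\<close>
        cancels.\<close>
      by (simp only: q_deriv_q_power_sum_gf[OF q] mult.left_commute[of elem_gf]
            q_power_sum_identity(2) mult_1_right)
    show "q_deriv symfun_const q (q_compose symfun_const q (q_exp symfun_const q) ?F)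
        = q_compose symfun_const q (q_exp symfun_const q) ?F * q_deriv symfun_const q ?F"
      by (rule q_deriv_q_compose_q_exp[OF facts])
    show "fps_nth elem_gf 0
        = fps_nth (q_compose symfun_const q (q_exp symfun_const q) ?F) 0"
      by (simp add: elem_gf_def q_compose_q_exp[OF facts]
            unital_ring_hom_simps(1)[OF unital_ring_hom_symfun_const])
  qed
qed

end
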